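(* Let $n\in\mathbb{N}=\{0,1,2,\dots\}$, let $\beta\in\mathbb{C}$ and let $k_1\in\mathbb{C}\setminus\{0\}$. Let $G_1(B_n'',B_n',B_n,t)=0$ be the second-order, second-degree differential equation defined in the context (with $'=d/dt$). This equation is reduced to the fifth Painlevé equation by the transformation $$B_n(t)=\frac{1+n+(\beta-3n-2)\,y+(1+2n-\beta)\,y^2+t\,y'}{2y(y-1)},$$ where $y=y(t)$ satisfies the fifth Painlevé equation with parameters $$A=\frac{(\beta-1)^2}{2},\qquad B=-\frac{(n+1)^2}{2},\qquad C=2k_1,\qquad D=0.$$ That is: whenever $y$ is a holomorphic function on a domain $\Omega\subset\mathbb{C}\setminus\{0\}$, not taking the values $0$ and $1$, which satisfies on $\Omega$ $$y''=\left(\frac{1}{2y}+\frac{1}{y-1}\right)(y')^2-\frac{y'}{t}+\frac{(y-1)^2}{t^2}\left(\frac{(\beta-1)^2}{2}\,y-\frac{(n+1)^2}{2y}\right)+\frac{2k_1\,y}{t},$$ the function $B_n$ given by the formula above satisfies $G_1(B_n''(t),B_n'(t),B_n(t),t)=0$ for all $t\in\Omega$.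
   Context: The fifth Painlevé equation with parameters $A,B,C,D\in\mathbb{C}$ is $$y''=\left(\frac{1}{2y}+\frac{1}{y-1}\right)(y')^2-\frac{y'}{t}+\frac{(y-1)^2}{t^2}\left(Ay+\frac{B}{y}\right)+\frac{Cy}{t}+\frac{Dy(y+1)}{y-1},\qquad y=y(t).$$ Origin of the equation $G_1=0$. Let $xP_n(x)=P_{n+1}(x)+b_nP_n(x)+a_n^2P_{n-1}(x)$ be the three-term recurrence relation of the monic orthogonal polynomials for the generalized Charlier weight $w(k)=a^k/((\beta)_k\,k!)$, $k\in\mathbb{N}$, $a>0$, and view $x_n=a_n^2$ and $b_n$ as functions of $a$. They satisfy the discrete system $$b_n+b_{n-1}-n+\beta=\frac{an}{x_n},\qquad (x_{n+1}-a)(x_n-a)=a(b_n-n)(b_n-n+\beta-1),$$ and the Toda system $\frac{dx_n}{da}=\frac{x_n}{a}(b_n-b_{n-1})$, $\frac{db_n}{da}=\frac1a(x_{n+1}-x_n)$. Eliminating $x_{n+1}$ and $b_{n-1}$ gives $$\frac{dx_n}{da}=\frac{(\beta-n+2b_n)x_n-an}{a},\qquad \frac{db_n}{da}=\frac{a(n-a+n^2-n\beta)-a(1+2n-\beta)b_n+ab_n^2+2ax_n-x_n^2}{a(x_n-a)}.\qquad( * )$$ The second-order equation $G(b_n'',b_n',b_n,a)=0$ (here $'=d/da$) is obtained from $( * )$ by differentiating the second equation of $( * )$, replacing $dx_n/da$ by the first equation, and eliminating $x_n$ by a resultant. Explicit definition. Treat $q,p,b,a,x$ as independent variables (standing for $b_n'',b_n',b_n,a,x_n$)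 and put $$N=a(n-a+n^2-n\beta)-a(1+2n-\beta)b+ab^2+2ax-x^2,\qquad X=\frac{(\beta-n+2b)x-an}{a},$$ $$E_1=a(x-a)\,p-N,$$ $$E_2=a\left[a(x-a)\,q+(x-2a)\,p+a\,p\,X-\frac{\partial N}{\partial a}-p\,\frac{\partial N}{\partial b}-X\,\frac{\partial N}{\partial x}\right].$$ ($E_1=0$ is the second equation of $( * )$ with denominators cleared; $E_2=0$ is its derivative with respect to $a$, using the first equation of $( * )$, with denominators cleared.) Both $E_1$ and $E_2$ are polynomials in $x$ of degree at most $2$, and $$G(q,p,b,a)=\operatorname{Res}_x(E_1,E_2),$$ the resultant of $E_1$ and $E_2$ with respect to $x$, both being regarded as polynomials of formal degree $2$ in $x$. Rescaling. Setting $b_n(a)=B_n(a/k_1)$ and $a=k_1t$, the equation $G(b_n'',b_n',b_n,a)=0$ becomes $G_1(B_n'',B_n',B_n,t)=0$, where now $'=d/dt$, i.e. $$G_1(q,p,b,t)=G\!\left(\frac{q}{k_1^2},\frac{p}{k_1},b,k_1t\right).$$ *)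

theory Defs
  imports
    "HOL-Analysis.Analysis"
    "Subresultants.Resultant_Prelim"
begin

definition painleve5_on ::
  "complex \<Rightarrow> complex \<Rightarrow> complex \<Rightarrow> complex \<Rightarrow> complex set \<Rightarrow> (complex \<Rightarrow> complex) \<Rightarrow> bool"
where
  "painleve5_on A B C D \<Omega> y \<longleftrightarrow>
    (\<forall>t\<in>\<Omega>. deriv (deriv y) t =
       (1 / (2 * y t) + 1 / (y t - 1)) * (deriv y t)^2 - deriv y t / t
       + (y t - 1)^2 / t^2 * (A * y t + B / y t)
       + C * y t / t + D * y t * (y t + 1) / (y t - 1))"

text \<open>
  The right-hand sides of the differential system for the recurrence coefficients
  \<open>b\<^sub>n\<close> and \<open>x\<^sub>n = a\<^sub>n\<^sup>2\<close> of the generalized Charlier polynomials are \<open>charlier_X\<close>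
  (for \<open>x\<^sub>n\<close>) and \<open>charlier_N\<close> divided by \<open>a * (x - a)\<close> (for \<open>b\<^sub>n\<close>).
\<close>

definition charlier_N :: "nat \<Rightarrow> complex \<Rightarrow> complex \<Rightarrow> complex \<Rightarrow> complex \<Rightarrow> complex" where
  "charlier_N n \<beta> b a x =
     a * (of_nat n - a + of_nat n ^ 2 - of_nat n * \<beta>) - a * (1 + 2 * of_nat n - \<beta>) * b
     + a * b^2 + 2 * a * x - x^2"

definition charlier_X :: "nat \<Rightarrow> complex \<Rightarrow> complex \<Rightarrow> complex \<Rightarrow> complex \<Rightarrow> complex" where
  "charlier_X n \<beta> b a x = ((\<beta> - of_nat n + 2 * b) * x - a * of_nat n) / a"

definition charlier_E1 :: "nat \<Rightarrow> complex \<Rightarrow> complex \<Rightarrow> complex \<Rightarrow> complex \<Rightarrow> complex \<Rightarrow> complex" where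
  "charlier_E1 n \<beta> p b a x = a * (x - a) * p - charlier_N n \<beta> b a x"

text \<open>
  In the next definition the three \<open>deriv\<close> terms are the partial derivatives of
  \<open>charlier_N\<close> with respect to \<open>a\<close>, \<open>b\<close> and \<open>x\<close>. The denominator of \<open>charlier_X\<close>
  is cancelled by the outer factor \<open>a\<close> only for \<open>a \<noteq> 0\<close>; with the convention
  \<open>z / 0 = 0\<close> the value at \<open>a = 0\<close> is not meaningful.
\<close>

definition charlier_E2 ::
  "nat \<Rightarrow> complex \<Rightarrow> complex \<Rightarrow> complex \<Rightarrow> complex \<Rightarrow> complex \<Rightarrow> complex \<Rightarrow> complex"
where
  "charlier_E2 n \<beta> q p b a x =
     a * (a * (x - a) * q + (x - 2 * a) * p + a * p * charlier_X n \<beta> b a x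
          - deriv (\<lambda>a'. charlier_N n \<beta> b a' x) a
          - p * deriv (\<lambda>b'. charlier_N n \<beta> b' a x) b
          - charlier_X n \<beta> b a x * deriv (\<lambda>x'. charlier_N n \<beta> b a x') x)"

text \<open>
  The polynomial inducing a given polynomial function; it is unique because the
  field of complex numbers is infinite.
\<close>

definition poly_of_fun :: "(complex \<Rightarrow> complex) \<Rightarrow> complex poly" where
  "poly_of_fun f = (THE P. poly P = f)"

lemma poly_of_fun_poly: "poly_of_fun (poly P) = P"
  unfolding poly_of_fun_def by (rule the_equality) (auto simp: poly_eq_poly_eq_iff)

text \<open>
  The resultant for prescribed formal degrees \<open>m\<close> and \<open>k\<close>. The library constant
  \<open>resultant\<close> uses the actual degrees instead, which may drop for special values
  of the parameters.
\<close>

definition formal_resultant :: "nat \<Rightarrow> nat \<Rightarrow> complex poly \<Rightarrow> complex poly \<Rightarrow> complex" where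
  "formal_resultant m k P Q = Determinant.det (sylvester_mat_sub m k P Q)"

definition charlier_G :: "nat \<Rightarrow> complex \<Rightarrow> complex \<Rightarrow> complex \<Rightarrow> complex \<Rightarrow> complex \<Rightarrow> complex" where
  "charlier_G n \<beta> q p b a =
     formal_resultant 2 2 (poly_of_fun (\<lambda>x. charlier_E1 n \<beta> p b a x))
                          (poly_of_fun (\<lambda>x. charlier_E2 n \<beta> q p b a x))"

definition charlier_G1 ::
  "nat \<Rightarrow> complex \<Rightarrow> complex \<Rightarrow> complex \<Rightarrow> complex \<Rightarrow> complex \<Rightarrow> complex \<Rightarrow> complex"
where
  "charlier_G1 n \<beta> k1 q p b t = charlier_G n \<beta> (q / k1^2) (p / k1) b (k1 * t)"

end

theory Submission
  imports Defs "HOL-Complex_Analysis.Cauchy_Integral_Formula"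
begin

text \<open>
  The equation \<open>G = 0\<close> is what remains of the first-order system for \<open>(x, b)\<close> after
  \<open>x\<close> is eliminated by a resultant. The elimination need not be carried out: a resultant
  vanishes as soon as its two arguments have a common root, so it suffices to exhibit the
  eliminated function \<open>x\<close> explicitly in terms of the Painleve transcendent \<open>y\<close>.

  Write \<open>a = k1 * t\<close>, \<open>f = b - n\<close>, \<open>g = b - n + \<beta> - 1\<close> and \<open>x = a + u\<close>. In these variables
  the equation for \<open>b\<close> in the system is \<open>u * (a * db/da) = a * f * g - u^2\<close>, and the equation for
  \<open>x\<close> is \<open>a * du/da = (f + g + n + 1) * u + a * (f + g)\<close>. In the discrete system
  \<open>(x\<^sub>n\<^sub>+\<^sub>1 - a) * (x\<^sub>n - a) = a * f * g\<close>, so \<open>v = x\<^sub>n\<^sub>+\<^sub>1 - a\<close> satisfies \<open>u * v = a * f * g\<close> and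
  \<open>a * db/da = v - u\<close>. The transformation formula for \<open>B\<close> is equivalent to
  \<open>t * y' = (y - 1) * (y * (f + g) + n + 1)\<close>, which is what the discrete and
  the Toda system imply for \<open>v\<close> if \<open>v = a / (y - 1)\<close>. This forces \<open>u = f * g * (y - 1)\<close>,
  which is holomorphic wherever \<open>b\<close> and \<open>y\<close> are.

  With this \<open>x\<close>, the fifth Painleve equation becomes \<open>t * B' = v - u\<close>
  (\<open>painleve5_backlund_derivative\<close>), which implies \<open>E1 = 0\<close>; together with the formula for \<open>t * y'\<close> it
  also gives the equation for \<open>x\<close>. Since \<open>E2\<close> is, up to a nonzero factor, the derivative of
  \<open>E1\<close> along the system (\<open>has_field_derivative_charlier_E1\<close>), \<open>E2 = 0\<close> follows
  because \<open>E1\<close> vanishes on an open set, and \<open>x\<close> is the common root required.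
\<close>

section \<open>Resultants and common roots\<close>

lemma poly_eq_sum_atMost:
  fixes x :: "'a::{comm_semiring_0,semiring_1}"
  assumes "degree P \<le> m"
  shows "poly P x = (\<Sum>l\<le>m. coeff P l * x ^ l)"
  unfolding poly_altdef using assms
  by (intro sum.mono_neutral_left) (auto simp: coeff_eq_0)

text \<open>
  For a common root \<open>x\<close>, the vector of the powers \<open>x ^ (m + k - 1), \<dots>, x, 1\<close> lies in the kernel of
  the Sylvester matrix: each row times this vector is \<open>poly P x\<close> or \<open>poly Q x\<close> times a
  power of \<open>x\<close>. Its last entry is \<open>1\<close>, also for \<open>x = 0\<close>, so it is not the zero vector. Leading
  coefficients never enter, so the formal degrees may exceed the actual ones.
\<close>

lemma formal_resultant_eq_0_if_common_root:
  assumes deg: "degree P \<le> m" "degree Q \<le> k" and "0 < m + k"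
    and root: "poly P x = 0" "poly Q x = 0"
  shows "formal_resultant m k P Q = 0"
proof -
  define S where "S = sylvester_mat_sub m k P Q"
  define v where "v = vec (m + k) (\<lambda>j. x ^ (m + k - 1 - j))"
  have S: "S \<in> carrier_mat (m + k) (m + k)"
    unfolding S_def by (rule sylvester_mat_sub_carrier)
  have "v \<noteq> 0\<^sub>v (m + k)"
  proof
    assume "v = 0\<^sub>v (m + k)"
    then have "v $ (m + k - 1) = 0" using \<open>0 < m + k\<close> by simp
    then show False using \<open>0 < m + k\<close> by (simp add: v_def)
  qed
  moreover have "S *\<^sub>v v = 0\<^sub>v (m + k)"
  proof (rule eq_vecI)
    fix i assume "i < dim_vec (0\<^sub>v (m + k) :: complex vec)"
    then have i: "i < m + k" by simp
    have expand: "(S *\<^sub>v v) $ i = (\<Sum>j<m + k. S $$ (i, j) * x ^ (m + k - 1 - j))"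
      using i S by (simp add: scalar_prod_def v_def atLeast0LessThan)
    show "(S *\<^sub>v v) $ i = 0\<^sub>v (m + k) $ i"
    proof (cases "i < k")
      case True
      have "(\<Sum>j<m + k. S $$ (i, j) * x ^ (m + k - 1 - j))
          = (\<Sum>j\<in>{i..i + m}. coeff P (m + i - j) * x ^ (m + k - 1 - j))"
        using True i by (intro sum.mono_neutral_cong_right)
          (auto simp: S_def sylvester_mat_sub_index)
      also have "\<dots> = (\<Sum>l\<le>m. coeff P l * x ^ (l + (k - 1 - i)))"
        using True by (intro sum.reindex_bij_witness[of _ "\<lambda>l. m + i - l" "\<lambda>j. m + i - j"]) auto
      also have "\<dots> = poly P x * x ^ (k - 1 - i)"
        by (simp add: poly_eq_sum_atMost [OF deg(1)] power_add sum_distrib_right mult.assoc)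
      finally show ?thesis using root expand i by simp
    next
      case False
      have "(\<Sum>j<m + k. S $$ (i, j) * x ^ (m + k - 1 - j))
          = (\<Sum>j\<in>{i - k..i}. coeff Q (i - j) * x ^ (m + k - 1 - j))"
        using False i by (intro sum.mono_neutral_cong_right)
          (auto simp: S_def sylvester_mat_sub_index)
      also have "\<dots> = (\<Sum>l\<le>k. coeff Q l * x ^ (l + (m + k - 1 - i)))"
        using False i by (intro sum.reindex_bij_witness[of _ "\<lambda>l. i - l" "\<lambda>j. i - j"]) auto
      also have "\<dots> = poly Q x * x ^ (m + k - 1 - i)"
        by (simp add: poly_eq_sum_atMost [OF deg(2)] power_add sum_distrib_right mult.assoc)
      finally show ?thesis using root expand i by simp
    qed
  qed (use S in auto)
  moreover have "v \<in> carrier_vec (m + k)" by (simp add: v_def)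
  ultimately show ?thesis
    using det_0_iff_vec_prod_zero[OF S] unfolding formal_resultant_def S_def by blast
qed

text \<open>Centred at \<open>x = a\<close>, the polynomial is the right-hand side \<open>a * f * g - u^2\<close>.\<close>

lemma charlier_N_centred:
  "charlier_N n \<beta> b a x = a * ((b - of_nat n) * (b - of_nat n + (\<beta> - 1))) - (x - a)^2"
  by (simp add: charlier_N_def algebra_simps power2_eq_square)

lemma deriv_charlier_N:
  "deriv (\<lambda>a'. charlier_N n \<beta> b a' x) a =
     of_nat n - 2 * a + of_nat n ^ 2 - of_nat n * \<beta> - (1 + 2 * of_nat n - \<beta>) * b + b^2 + 2 * x"
  "deriv (\<lambda>b'. charlier_N n \<beta> b' a x) b = 2 * a * b - a * (1 + 2 * of_nat n - \<beta>)"
  "deriv (\<lambda>x'. charlier_N n \<beta> b a x') x = 2 * a - 2 * x"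
  unfolding charlier_N_def
  by (rule DERIV_imp_deriv, (rule derivative_eq_intros refl)+,
      simp add: algebra_simps power2_eq_square)+

lemma charlier_G_eq_0_if_common_root:
  assumes root: "charlier_E1 n \<beta> p b a x = 0" "charlier_E2 n \<beta> q p b a x = 0"
  shows "charlier_G n \<beta> q p b a = 0"
proof -
  \<comment> \<open>Explicit quadratics in \<open>x\<close> are needed because \<open>poly_of_fun\<close> has a meaning only for
    functions that are known to be polynomial.\<close>
  define P where "P =
    [: - a * a * p - a * (of_nat n - a + of_nat n ^ 2 - of_nat n * \<beta>)
         + a * (1 + 2 * of_nat n - \<beta>) * b - a * b^2,
       a * p - 2 * a, 1 :]"
  have P: "charlier_E1 n \<beta> p b a = poly P"
    by (rule ext) (simp add: P_def charlier_E1_def charlier_N_def algebra_simps power2_eq_square)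
  define X0 X1 where "X0 = - (a * of_nat n / a)" and "X1 = (\<beta> - of_nat n + 2 * b) / a"
  have X: "charlier_X n \<beta> b a z = X0 + X1 * z" for z
    by (simp add: charlier_X_def X0_def X1_def diff_divide_distrib)
  define Q where "Q = Polynomial.smult a
    [: - a * a * q - 2 * a * p + a * p * X0
         - (of_nat n - 2 * a + of_nat n ^ 2 - of_nat n * \<beta> - (1 + 2 * of_nat n - \<beta>) * b + b^2)
         - p * (2 * a * b - a * (1 + 2 * of_nat n - \<beta>)) - 2 * a * X0,
       a * q + p + a * p * X1 - 2 - 2 * a * X1 + 2 * X0, 2 * X1 :]"
  have Q: "charlier_E2 n \<beta> q p b a = poly Q"
    by (rule ext) (simp add: Q_def charlier_E2_def deriv_charlier_N X algebra_simps power2_eq_square)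
  have "degree P \<le> 2" by (simp add: P_def)
  moreover have "degree Q \<le> 2"
    unfolding Q_def by (rule order.trans[OF degree_smult_le]) simp
  ultimately have "formal_resultant 2 2 P Q = 0"
    using root by (intro formal_resultant_eq_0_if_common_root[where x = x]) (auto simp: P Q)
  then show ?thesis
    by (simp add: charlier_G_def P Q poly_of_fun_poly)
qed

section \<open>The resultant equation along solutions of the first-order system\<close>

text \<open>
  The chain rule that produced \<open>charlier_E2\<close>, in the variable \<open>t\<close> with \<open>a = k * t\<close>. Every
  derivative with respect to \<open>a\<close> gains a factor \<open>k\<close>, while \<open>charlier_E2\<close> carries a factor
  \<open>a\<close> to clear the denominator; the quotient of the two factors is \<open>t\<close>.
\<close>

lemma has_field_derivative_charlier_E1:
  assumes "k \<noteq> 0" "t \<noteq> 0"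
    and p: "(p has_field_derivative k * q) (at t)"
    and b: "(b has_field_derivative k * p t) (at t)"
    and x: "(x has_field_derivative k * charlier_X n \<beta> (b t) (k * t) (x t)) (at t)"
  shows "((\<lambda>s. charlier_E1 n \<beta> (p s) (b s) (k * s) (x s)) has_field_derivative
           charlier_E2 n \<beta> q (p t) (b t) (k * t) (x t) / t) (at t)"
proof -
  define X where "X = charlier_X n \<beta> (b t) (k * t) (x t)"
  have "charlier_E2 n \<beta> q (p t) (b t) (k * t) (x t) / t =
      k * (k * t * (x t - k * t) * q + (x t - 2 * (k * t)) * p t + k * t * p t * X
           - (of_nat n - 2 * (k * t) + of_nat n ^ 2 - of_nat n * \<beta>
                - (1 + 2 * of_nat n - \<beta>) * b t + (b t)^2 + 2 * x t)
           - p t * (2 * (k * t) * b t - k * t * (1 + 2 * of_nat n - \<beta>))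
           - X * (2 * (k * t) - 2 * x t))"
    using \<open>t \<noteq> 0\<close> by (simp add: charlier_E2_def deriv_charlier_N X_def)
  then show ?thesis
    unfolding charlier_E1_def charlier_N_def
    by (rule ssubst) ((rule derivative_eq_intros p b x[folded X_def] refl)+,
      simp add: algebra_simps power2_eq_square)
qed

text \<open>
  \<open>charlier_E1\<close> has to vanish on all of \<open>\<Omega>\<close>, not just at \<open>t\<close>, because it is its derivative along
  the solution that yields \<open>charlier_E2\<close>; this also brings in the second derivative of \<open>b\<close>.
\<close>

lemma charlier_G1_eq_0_if_system:
  assumes "k \<noteq> 0" "0 \<notin> \<Omega>" "open \<Omega>" "b holomorphic_on \<Omega>" "t \<in> \<Omega>"
    and E1: "\<And>s. s \<in> \<Omega> \<Longrightarrow> charlier_E1 n \<beta> (deriv b s / k) (b s) (k * s) (x s) = 0"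
    and x: "(x has_field_derivative k * charlier_X n \<beta> (b t) (k * t) (x t)) (at t)"
  shows "charlier_G1 n \<beta> k (deriv (deriv b) t) (deriv b t) (b t) t = 0"
proof -
  let ?q = "deriv (deriv b) t / k^2"
  have "t \<noteq> 0" using assms by auto
  have b: "(b has_field_derivative k * (deriv b t / k)) (at t)"
    using assms by (auto intro: holomorphic_derivI)
  have "(deriv b has_field_derivative deriv (deriv b) t) (at t)"
    using assms by (auto intro: holomorphic_derivI holomorphic_deriv)
  then have p: "((\<lambda>s. deriv b s / k) has_field_derivative k * ?q) (at t)"
    using \<open>k \<noteq> 0\<close> by (auto intro!: derivative_eq_intros simp: power2_eq_square)
  have "((\<lambda>s. charlier_E1 n \<beta> (deriv b s / k) (b s) (k * s) (x s)) has_field_derivative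
          charlier_E2 n \<beta> ?q (deriv b t / k) (b t) (k * t) (x t) / t) (at t)"
    by (rule has_field_derivative_charlier_E1[OF \<open>k \<noteq> 0\<close> \<open>t \<noteq> 0\<close> p b x])
  moreover have "((\<lambda>s. charlier_E1 n \<beta> (deriv b s / k) (b s) (k * s) (x s))
          has_field_derivative 0) (at t)"
    by (rule has_field_derivative_transform_within_open[OF DERIV_const \<open>open \<Omega>\<close> \<open>t \<in> \<Omega>\<close>])
      (simp add: E1)
  ultimately have "charlier_E2 n \<beta> ?q (deriv b t / k) (b t) (k * t) (x t) = 0"
    using DERIV_unique \<open>t \<noteq> 0\<close> by fastforce
  with E1[OF \<open>t \<in> \<Omega>\<close>] show ?thesis
    unfolding charlier_G1_def by (rule charlier_G_eq_0_if_common_root)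
qed

section \<open>From the fifth Painleve equation to the first-order system\<close>

text \<open>
  The equation for \<open>v - u\<close> in algebraic form. Here \<open>s\<close> stands for \<open>t * y'\<close>, and \<open>s'\<close>, \<open>f'\<close> for
  \<open>t * ds/dt\<close>, \<open>t * df/dt\<close>; the second hypothesis on \<open>s'\<close> is the first-order relation for \<open>s\<close>
  differentiated, and the first one is the fifth Painleve equation with \<open>D = 0\<close>, parameters
  \<open>c^2 / 2\<close>, \<open>- (m^2 / 2)\<close> and \<open>C * t = 2 * a\<close>. With \<open>w = y * (2 * f + c) + m\<close>, the terms free of
  \<open>a\<close> and \<open>f'\<close> collapse to a multiple of \<open>w^2 - 2 * y * (2 * f + c) * w + c^2 * y^2 - m^2\<close>; as
  \<open>w - y * (2 * f + c) = m\<close>, this is \<open>y^2 * (c^2 - (2 * f + c)^2) = - 4 * y^2 * f * (f + c)\<close>.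
\<close>

lemma painleve5_backlund_derivative:
  fixes y s s' f f' a c m :: complex
  assumes y: "y \<noteq> 0" "y \<noteq> 1"
    and s: "s = (y - 1) * (y * (2 * f + c) + m)"
    and s': "s' = (3 * y - 1) / (2 * y * (y - 1)) * s^2
               + (y - 1)^2 * (c^2 * y^2 - m^2) / (2 * y) + 2 * a * y"
    and f': "s' = s * (y * (2 * f + c) + m) + (y - 1) * (s * (2 * f + c) + 2 * y * f')"
  shows "f' = a / (y - 1) - f * (f + c) * (y - 1)"
proof -
  have 1: "2 * y * (y - 1) * s' = (3 * y - 1) * s^2 + (y - 1)^3 * (c^2 * y^2 - m^2)
              + 4 * a * y^2 * (y - 1)"
    using y unfolding s' by (simp add: field_simps) (simp add: algebra_simps power3_eq_cube power2_eq_square)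
  have "4 * y^2 * (y - 1) * ((y - 1) * f' - (a - f * (f + c) * (y - 1)^2)) =
      2 * y * (y - 1) * s' - ((3 * y - 1) * s^2 + (y - 1)^3 * (c^2 * y^2 - m^2)
              + 4 * a * y^2 * (y - 1))"
    unfolding f' s by (simp add: algebra_simps power2_eq_square power3_eq_cube)
  then have "4 * y^2 * (y - 1) * ((y - 1) * f' - (a - f * (f + c) * (y - 1)^2)) = 0"
    using 1 by simp
  then have "(y - 1) * f' = a - f * (f + c) * (y - 1)^2" using y by simp
  then show ?thesis using y by (simp add: field_simps power2_eq_square)
qed

theorem theorem2p1:
  fixes n :: nat and \<beta> k1 :: complex
    and \<Omega> :: "complex set" and y B :: "complex \<Rightarrow> complex"
  assumes "k1 \<noteq> 0"
    and "open \<Omega>" and "connected \<Omega>" and "\<Omega> \<noteq> {}" and "0 \<notin> \<Omega>"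
    and "y holomorphic_on \<Omega>"
    and "\<forall>t\<in>\<Omega>. y t \<noteq> 0 \<and> y t \<noteq> 1"
    and "painleve5_on ((\<beta> - 1)^2 / 2) (- ((of_nat n + 1)^2 / 2)) (2 * k1) 0 \<Omega> y"
    and "\<forall>t\<in>\<Omega>. B t =
           (1 + of_nat n + (\<beta> - 3 * of_nat n - 2) * y t
            + (1 + 2 * of_nat n - \<beta>) * (y t)^2 + t * deriv y t)
           / (2 * y t * (y t - 1))"
  shows "\<forall>t\<in>\<Omega>. charlier_G1 n \<beta> k1 (deriv (deriv B) t) (deriv B t) (B t) t = 0"
proof -
  define c m :: complex where "c = \<beta> - 1" and "m = of_nat n + 1"
  define f where "f = (\<lambda>t. B t - of_nat n)"
  \<comment> \<open>The common root: \<open>a + u\<close> with \<open>u = f * g * (y - 1)\<close>.\<close>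
  define x where "x = (\<lambda>t. k1 * t + f t * (f t + c) * (y t - 1))"
  have y_ne: "y t \<noteq> 0" "y t \<noteq> 1" "t \<noteq> 0" if "t \<in> \<Omega>" for t
    using assms(5,7) that by auto
  have dy: "(y has_field_derivative deriv y t) (at t)"
    and ddy: "(deriv y has_field_derivative deriv (deriv y) t) (at t)" if "t \<in> \<Omega>" for t
    using assms(2,6) that by (auto intro: holomorphic_derivI holomorphic_deriv)
  have "(\<lambda>t. (1 + of_nat n + (\<beta> - 3 * of_nat n - 2) * y t
            + (1 + 2 * of_nat n - \<beta>) * (y t)^2 + t * deriv y t)
           / (2 * y t * (y t - 1))) holomorphic_on \<Omega>"
    using assms(2,6) y_ne by (auto intro!: holomorphic_intros holomorphic_deriv)
  then have B_holo: "B holomorphic_on \<Omega>"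
    using assms(9) by (auto cong: holomorphic_cong)
  then have df: "(f has_field_derivative deriv B t) (at t)" if "t \<in> \<Omega>" for t
    unfolding f_def using assms(2) that
    by (auto intro!: derivative_eq_intros holomorphic_derivI)
  have s: "t * deriv y t = (y t - 1) * (y t * (2 * f t + c) + m)" if "t \<in> \<Omega>" for t
  proof -
    have "t * deriv y t = 2 * y t * (y t - 1) * B t -
        (1 + of_nat n + (\<beta> - 3 * of_nat n - 2) * y t + (1 + 2 * of_nat n - \<beta>) * (y t)^2)"
      using assms(9) y_ne[OF that] that by simp
    also have "\<dots> = (y t - 1) * (y t * (2 * f t + c) + m)"
      unfolding f_def c_def m_def by (simp add: algebra_simps power2_eq_square)
    finally show ?thesis .
  qed
  \<comment> \<open>The equation \<open>t * B' = v - u\<close>, and then the same without the denominator.\<close>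
  have shift: "t * deriv B t = k1 * t / (y t - 1) - f t * (f t + c) * (y t - 1)"
    if t: "t \<in> \<Omega>" for t
  proof (rule painleve5_backlund_derivative[where m = m, OF y_ne(1,2)[OF t] s[OF t]])
    let ?s' = "t * deriv y t + t^2 * deriv (deriv y) t"
    show "?s' = (3 * y t - 1) / (2 * y t * (y t - 1)) * (t * deriv y t)^2
               + (y t - 1)^2 * (c^2 * (y t)^2 - m^2) / (2 * y t) + 2 * (k1 * t) * y t"
    proof -
      have "deriv (deriv y) t =
       (1 / (2 * y t) + 1 / (y t - 1)) * (deriv y t)^2 - deriv y t / t
       + (y t - 1)^2 / t^2 * (c^2 / 2 * y t - (m^2 / 2) / y t)
       + 2 * k1 * y t / t"
        using assms(8) t by (simp add: painleve5_on_def c_def m_def)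
      moreover have "1 / (2 * y t) + 1 / (y t - 1) = (3 * y t - 1) / (2 * y t * (y t - 1))"
        using y_ne[OF t] by (simp add: divide_simps)
      moreover have "c^2 / 2 * y t - (m^2 / 2) / y t = (c^2 * (y t)^2 - m^2) / (2 * y t)"
        using y_ne[OF t] by (simp add: divide_simps power2_eq_square)
      ultimately have "deriv (deriv y) t =
         (3 * y t - 1) / (2 * y t * (y t - 1)) * (deriv y t)^2 - deriv y t / t
       + (y t - 1)^2 / t^2 * ((c^2 * (y t)^2 - m^2) / (2 * y t))
       + 2 * k1 * y t / t" by simp
      then show ?thesis
        using y_ne(3)[OF t] by (simp add: distrib_left right_diff_distrib power_mult_distrib)
          (simp add: power2_eq_square)
    qed
    \<comment> \<open>Differentiate both sides of the relation \<open>s\<close>.\<close>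
    have "((\<lambda>t. t * deriv y t) has_field_derivative deriv y t + t * deriv (deriv y) t) (at t)"
      by (rule derivative_eq_intros ddy t refl)+ simp
    moreover have "((\<lambda>t. (y t - 1) * (y t * (2 * f t + c) + m)) has_field_derivative
       deriv y t * (y t * (2 * f t + c) + m)
         + (y t - 1) * (deriv y t * (2 * f t + c) + 2 * y t * deriv B t)) (at t)"
      by (rule derivative_eq_intros dy df t refl)+ (simp add: algebra_simps)
    then have "((\<lambda>t. t * deriv y t) has_field_derivative
       deriv y t * (y t * (2 * f t + c) + m)
         + (y t - 1) * (deriv y t * (2 * f t + c) + 2 * y t * deriv B t)) (at t)"
      by (rule has_field_derivative_transform_within_open[OF _ assms(2) t]) (simp add: s)
    ultimately have eq: "deriv y t + t * deriv (deriv y) t =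
       deriv y t * (y t * (2 * f t + c) + m)
         + (y t - 1) * (deriv y t * (2 * f t + c) + 2 * y t * deriv B t)"
      by (rule DERIV_unique)
    show "?s' = t * deriv y t * (y t * (2 * f t + c) + m)
        + (y t - 1) * (t * deriv y t * (2 * f t + c) + 2 * y t * (t * deriv B t))"
      using arg_cong[OF eq, of "\<lambda>z. t * z"] by (simp add: algebra_simps power2_eq_square)
  qed
  have shift': "(y t - 1) * (t * deriv B t) = k1 * t - f t * (f t + c) * (y t - 1)^2"
    if t: "t \<in> \<Omega>" for t
    using y_ne[OF t] by (simp add: shift[OF t] field_simps power2_eq_square)
  show ?thesis
  proof
    fix t assume t: "t \<in> \<Omega>"
    show "charlier_G1 n \<beta> k1 (deriv (deriv B) t) (deriv B t) (B t) t = 0"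
    proof (rule charlier_G1_eq_0_if_system[OF assms(1,5,2) B_holo t])
      fix t assume t: "t \<in> \<Omega>"
      have "k1 * t * (x t - k1 * t) * (deriv B t / k1)
          = f t * (f t + c) * ((y t - 1) * (t * deriv B t))"
        using assms(1) by (simp add: x_def)
      also have "\<dots> = k1 * t * (f t * (f t + c)) - (x t - k1 * t)^2"
        unfolding shift'[OF t] by (simp add: x_def algebra_simps power2_eq_square)
      also have "\<dots> = charlier_N n \<beta> (B t) (k1 * t) (x t)"
        by (simp add: charlier_N_centred f_def c_def)
      finally show "charlier_E1 n \<beta> (deriv B t / k1) (B t) (k1 * t) (x t) = 0"
        by (simp add: charlier_E1_def)
    next
      have "(x has_field_derivative k1 + deriv B t * (2 * f t + c) * (y t - 1)
               + f t * (f t + c) * deriv y t) (at t)"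
        unfolding x_def by (rule derivative_eq_intros dy df t refl)+ (simp add: algebra_simps)
      moreover have "k1 + deriv B t * (2 * f t + c) * (y t - 1) + f t * (f t + c) * deriv y t
          = k1 * charlier_X n \<beta> (B t) (k1 * t) (x t)"
      proof -
        have "t * (k1 + deriv B t * (2 * f t + c) * (y t - 1) + f t * (f t + c) * deriv y t)
            = k1 * t + (2 * f t + c) * ((y t - 1) * (t * deriv B t))
              + f t * (f t + c) * (t * deriv y t)"
          by (simp add: algebra_simps)
        also have "\<dots> = (2 * f t + c + m) * x t - k1 * t * (m - 1)"
          unfolding shift'[OF t] s[OF t] x_def by (simp add: algebra_simps power2_eq_square)
        also have "\<dots> = (\<beta> - of_nat n + 2 * B t) * x t - k1 * t * of_nat n"
          by (simp add: f_def c_def m_def)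
        also have "\<dots> = t * (k1 * charlier_X n \<beta> (B t) (k1 * t) (x t))"
          using y_ne(3)[OF t] assms(1) by (simp add: charlier_X_def)
        finally show ?thesis using y_ne(3)[OF t] by simp
      qed
      ultimately show "(x has_field_derivative k1 * charlier_X n \<beta> (B t) (k1 * t) (x t)) (at t)"
        by simp
    qed
  qed
qed

end
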